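(* Let $G=(V,E)$ be any undirected graph with $n\ge 1$ nodes, and let $\mathcal I:V\to[n]$ be any indexing produced by Algorithm U (described in the context) on input $G$, for any choices made in breaking ties. Identify each node with its index under $\mathcal I$, so that for $v\in[n]$, $\mathcal N(v)\subseteq[n]$ denotes the set of indexes of the neighbors of the node with index $v$. Then $$LO(\mathcal N(v)\setminus\{v+1\})\le LO(\mathcal N(v+1)\setminus\{v\})\qquad\text{for all } v\in[n-1].$$
   Context: Graphs are finite, without self-loops or multiple edges. $[m]=\{0,1,\dots,m-1\}$. Lexicographical order $LO$: for integers $L,M$, $Seq(L,M)$ is the set of non-decreasing integer sequences $(a_1,\dots,a_L)$ with $0\le a_1\le\dots\le a_L\le M$. For $a,b\in Seq(L,M)$, $LO(a)<LO(b)$ means that there is $l\in\{1,\dots,L\}$ with $a_i=b_i$ for $1\le i<l$ and $a_l<b_l$; $LO(a)=LO(b)$ means $a=b$; $LO(a)\le LO(b)$ means one of these. For a multiset $S$ of at most $L$ integers in $[0,M-1]$, sort its elements in non-decreasing order and append copies of $M$ until the length is $L$; $LO(S)$ denotes $LO$ of the resulting sequence. Here $L=n-1$ and $M=n$. Algorithm U. Input: an undirected graph $G=(V,E)$ with $|V|=n$; $\mathcal N(v)\subseteq V$ is the set of neighbors of $v$. Set $V_1^0=\emptyset$. For $s=0,1,\dots,n-1$ in turn: (i) $V_2^s=V\setminus V_1^s$ (the unindexed nodes); (ii) for $v\in V_2^s$, $\mathcal N^s(v)=\{\mathcal I(u): u\in\mathcal N(v)\cap V_1^s\}$; (iii) for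 $v\in V_2^s$, $rank^s(v)$ is the number of distinct values $LO(\mathcal N^s(u))$, $u\in V_2^s$, with $LO(\mathcal N^s(u))<LO(\mathcal N^s(v))$; (iv) temporary indexes: $\mathcal I^s(v)=\mathcal I(v)$ for $v\in V_1^s$ and $\mathcal I^s(v)=rank^s(v)+s$ for $v\in V_2^s$; (v) for $v\in V_2^s$, $\mathcal N_t^s(v)$ is the multiset $\{\mathcal I^s(u): u\in\mathcal N(v)\}$; (vi) choose $v^s\in V_2^s$ minimizing $LO(\mathcal N_t^s(v))$ over $v\in V_2^s$ (ties broken arbitrarily), set $\mathcal I(v^s)=s$ and $V_1^{s+1}=V_1^s\cup\{v^s\}$. Output: the bijection $\mathcal I:V\to[n]$. *)

theory Defs
  imports
    "Graph_Theory.Digraph"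
    "HOL-Library.Multiset"
    "HOL-Library.List_Lexorder"
begin

text \<open>
  Undirected simple graphs are the symmetric, loop-free digraphs without parallel arcs of the
  locale \<^locale>\<open>graph\<close>: an edge between two nodes is a pair of opposite arcs.
\<close>

definition neighbors :: "('a, 'b) pre_digraph \<Rightarrow> 'a \<Rightarrow> 'a set" where
  "neighbors G v = {u. (v, u) \<in> arcs_ends G}"

text \<open>
  \<open>LO L M S\<close> is the sequence itself; sequences are compared with the lexicographic
  order on lists. All sequences that occur have length \<open>L\<close>, where that order is the
  usual one on sequences of equal length (\<open>LO_less_iff\<close> below).
\<close>

definition LO :: "nat \<Rightarrow> nat \<Rightarrow> nat multiset \<Rightarrow> nat list" where
  "LO L M S = sorted_list_of_multiset S @ replicate (L - size S) M"

abbreviation graph_LO :: "('a, 'b) pre_digraph \<Rightarrow> nat multiset \<Rightarrow> nat list" where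
  "graph_LO G \<equiv> LO (card (verts G) - 1) (card (verts G))"

lemma length_LO: "size S \<le> L \<Longrightarrow> length (LO L M S) = L"
  by (simp add: LO_def flip: size_mset)

lemma less_list_iff_nth:
  fixes a b :: "nat list"
  assumes "length a = length b"
  shows "a < b \<longleftrightarrow> (\<exists>l<length a. (\<forall>i<l. a ! i = b ! i) \<and> a ! l < b ! l)"
proof -
  have "a < b \<longleftrightarrow> (\<exists>i. i < min (length a) (length b) \<and> take i a = take i b \<and> a ! i < b ! i)"
    using assms by (auto simp: list_less_def lexord_take_index_conv)
  moreover have "take l a = take l b \<longleftrightarrow> (\<forall>i<l. a ! i = b ! i)" if "l < length a" for l
    using that assms by (auto simp: list_eq_iff_nth_eq)
  ultimately show ?thesis using assms by auto
qed

lemma LO_less_iff: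
  assumes "size S \<le> L" "size T \<le> L"
  shows "LO L M S < LO L M T \<longleftrightarrow>
    (\<exists>l<L. (\<forall>i<l. LO L M S ! i = LO L M T ! i) \<and> LO L M S ! l < LO L M T ! l)"
  using assms by (simp add: less_list_iff_nth length_LO)

text \<open>
  The state of the algorithm is the partial indexing \<open>I\<close> built so far; its domain is the
  set of indexed nodes.
\<close>

definition unindexed :: "('a, 'b) pre_digraph \<Rightarrow> ('a \<rightharpoonup> nat) \<Rightarrow> 'a set" where
  "unindexed G I = verts G - dom I"

definition indexed_nbrs :: "('a, 'b) pre_digraph \<Rightarrow> ('a \<rightharpoonup> nat) \<Rightarrow> 'a \<Rightarrow> nat set" where
  "indexed_nbrs G I v = (\<lambda>u. the (I u)) ` (neighbors G v \<inter> dom I)"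

definition rank :: "('a, 'b) pre_digraph \<Rightarrow> ('a \<rightharpoonup> nat) \<Rightarrow> 'a \<Rightarrow> nat" where
  "rank G I v = card {x \<in> (\<lambda>u. graph_LO G (mset_set (indexed_nbrs G I u))) ` unindexed G I.
                        x < graph_LO G (mset_set (indexed_nbrs G I v))}"

definition temp_index :: "('a, 'b) pre_digraph \<Rightarrow> nat \<Rightarrow> ('a \<rightharpoonup> nat) \<Rightarrow> 'a \<Rightarrow> nat" where
  "temp_index G s I v = (case I v of Some i \<Rightarrow> i | None \<Rightarrow> rank G I v + s)"

definition temp_nbrs :: "('a, 'b) pre_digraph \<Rightarrow> nat \<Rightarrow> ('a \<rightharpoonup> nat) \<Rightarrow> 'a \<Rightarrow> nat multiset" where
  "temp_nbrs G s I v = image_mset (temp_index G s I) (mset_set (neighbors G v))"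

text \<open>
  \<open>algU_run G s I\<close>: the first \<open>s\<close> rounds can produce the partial indexing \<open>I\<close>. Ties are
  broken arbitrarily because \<^const>\<open>is_arg_min\<close> holds of every minimizer.
\<close>

inductive algU_run :: "('a, 'b) pre_digraph \<Rightarrow> nat \<Rightarrow> ('a \<rightharpoonup> nat) \<Rightarrow> bool" for G where
  init: "algU_run G 0 Map.empty"
| step: "algU_run G s I \<Longrightarrow>
    is_arg_min (\<lambda>v. graph_LO G (temp_nbrs G s I v)) (\<lambda>v. v \<in> unindexed G I) v \<Longrightarrow>
    algU_run G (Suc s) (I(v \<mapsto> s))"

definition algU_output :: "('a, 'b) pre_digraph \<Rightarrow> ('a \<Rightarrow> nat) \<Rightarrow> bool" where
  "algU_output G I \<longleftrightarrow> (\<exists>J. algU_run G (card (verts G)) J \<and> (\<forall>v\<in>verts G. J v = Some (I v)))"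

text \<open>
  \<open>nbr_indexes G I i\<close> is the set of indexes of the neighbors of the node with index \<open>i\<close>; the
  inverse is meaningful since \<open>I\<close> is a bijection (\<open>algU_output_bij_betw\<close> below).
\<close>

definition nbr_indexes :: "('a, 'b) pre_digraph \<Rightarrow> ('a \<Rightarrow> nat) \<Rightarrow> nat \<Rightarrow> nat set" where
  "nbr_indexes G I i = I ` neighbors G (inv_into (verts G) I i)"

lemma algU_run_dom:
  assumes "algU_run G s I"
  shows "dom I \<subseteq> verts G \<and> finite (dom I) \<and> card (dom I) = s
    \<and> bij_betw (\<lambda>v. the (I v)) (dom I) {..<s}"
  using assms
proof induction
  case init
  then show ?case by (simp add: bij_betw_def)
next
  case (step s I v)
  have v: "v \<in> verts G" "v \<notin> dom I"
    using step.hyps(2) by (auto simp: is_arg_min_def unindexed_def)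
  have "bij_betw (\<lambda>u. the ((I(v \<mapsto> s)) u)) (dom I) {..<s}"
    using step.IH v by (subst bij_betw_cong[where g = "\<lambda>u. the (I u)"]) auto
  then have "bij_betw (\<lambda>u. the ((I(v \<mapsto> s)) u)) (dom I \<union> {v}) ({..<s} \<union> {s})"
    using v by (intro bij_betw_combine) (auto simp: bij_betw_def)
  then show ?case
    using step.IH v by (simp add: lessThan_Suc del: fun_upd_apply)
qed

lemma algU_output_bij_betw:
  assumes "graph G" "algU_output G I"
  shows "bij_betw I (verts G) {..<card (verts G)}"
proof -
  interpret graph G by fact
  obtain J where J: "algU_run G (card (verts G)) J" "\<forall>v\<in>verts G. J v = Some (I v)"
    using assms(2) by (auto simp: algU_output_def)
  have "dom J = verts G"
    using algU_run_dom[OF J(1)] J(2) by auto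
  then have "bij_betw (\<lambda>v. the (J v)) (verts G) {..<card (verts G)}"
    using algU_run_dom[OF J(1)] by simp
  then show ?thesis
    using J(2) by (subst (asm) bij_betw_cong[where g = I]) auto
qed

lemma algU_output_exists:
  assumes "graph G"
  shows "\<exists>I. algU_output G I"
proof -
  interpret graph G by fact
  have "s \<le> card (verts G) \<Longrightarrow> \<exists>J. algU_run G s J" for s
  proof (induction s)
    case 0
    then show ?case using algU_run.init by blast
  next
    case (Suc s)
    then obtain J where J: "algU_run G s J" by auto
    have "unindexed G J \<noteq> {}"
    proof
      assume "unindexed G J = {}"
      then have "card (verts G) \<le> card (dom J)"
        using algU_run_dom[OF J] by (intro card_mono) (auto simp: unindexed_def)
      then show False using Suc.prems algU_run_dom[OF J] by simp
    qed
    moreover have "finite (unindexed G J)" by (simp add: unindexed_def)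
    ultimately have "\<exists>v. is_arg_min (\<lambda>v. graph_LO G (temp_nbrs G s J v)) (\<lambda>v. v \<in> unindexed G J) v"
      using ex_is_arg_min_if_finite by blast
    then show ?case using algU_run.step[OF J] by blast
  qed
  then obtain J where J: "algU_run G (card (verts G)) J" by blast
  have "dom J = verts G"
    using algU_run_dom[OF J] by (intro card_subset_eq) auto
  then have "\<forall>v\<in>verts G. J v = Some (the (J v))" by force
  then show ?thesis using J unfolding algU_output_def by (intro exI[of _ "\<lambda>v. the (J v)"]) blast
qed

end

theory Submission
  imports Defs "HOL-Combinatorics.Transposition"
begin

text \<open>
  Lexicographic comparison of the padded sequences only depends on the first value at which two
  multisets have different multiplicities: the one with more copies is smaller
  (\<open>LO_less_iff_count\<close>). In this form removing a common element, or one element from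
  each side, is easy to follow.

  Restricted to values below \<open>s\<close>, the temporary neighbour multiset of an unindexed node at
  round \<open>s\<close> is already its final one. Hence if the final neighbour sets of \<open>u\<close>
  and \<open>w\<close> first differ at some \<open>x\<close> below the index of \<open>w\<close>, and
  \<open>x\<close> belongs to \<open>u\<close>, then \<open>u\<close> is indexed before \<open>w\<close>:
  otherwise \<open>u\<close> would have been preferred in the round that chose \<open>w\<close>
  (\<open>index_less_of_first_difference\<close>). Two consequences describe the final order of
  the nodes that are unindexed at round \<open>s\<close>. It refines the order of their ranks
  (\<open>index_less_of_tmp_less\<close>), and within one rank the neighbours of the node chosen at
  round \<open>s\<close> come before its non-neighbours (\<open>index_less_of_tmp_eq\<close>).

  Now let \<open>a\<close> and \<open>b\<close> have indexes \<open>i < j\<close>, and suppose that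
  \<open>LO (N b - {i}) < LO (N a - {j})\<close>. The first difference is the index \<open>x\<close>
  of a neighbour \<open>c\<close> of \<open>b\<close> that is not a neighbour of \<open>a\<close>. If
  \<open>x < i\<close>, then \<open>b\<close> would precede \<open>a\<close>. If \<open>x > i\<close>, consider
  the ranks at round \<open>i\<close>. All nodes of smaller rank than \<open>c\<close> have index below
  \<open>x\<close>, so \<open>a\<close> and \<open>b\<close> have equally many neighbours of each such rank.
  In the rank of \<open>c\<close> itself every neighbour of \<open>a\<close> has index below
  \<open>x\<close>, hence is matched by a neighbour of \<open>b\<close>, while \<open>c\<close> is an
  additional neighbour of \<open>b\<close>. So \<open>b\<close> had the smaller temporary sequence at
  round \<open>i\<close>, and the choice of \<open>a\<close> contradicts minimality. This argument works
  for any two nodes, not only for consecutive ones (\<open>LO_nbrs_mono\<close>).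
\<close>

section \<open>Lexicographic comparison by multiplicities\<close>

text \<open>
  In a sorted list the copies of small values come first, so the list with more copies of the
  first value that distinguishes them still shows this value where the other list has moved on to
  a larger one.
\<close>

lemma sorted_less_iff_count:
  fixes xs ys :: "nat list"
  assumes "length xs = length ys" "sorted xs" "sorted ys"
  shows "xs < ys \<longleftrightarrow>
    (\<exists>x. count (mset ys) x < count (mset xs) x \<and> (\<forall>y<x. count (mset xs) y = count (mset ys) y))"
  using assms
proof (induction xs ys rule: list_induct2)
  case Nil
  then show ?case by simp
next
  case (Cons a xs b ys)
  have absent_x: "count (mset (a # xs)) z = 0" if "z < a" for z
    using that Cons.prems(1) by (auto simp: count_eq_zero_iff simp del: mset.simps)
  have absent_y: "count (mset (b # ys)) z = 0" if "z < b" for z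
    using that Cons.prems(2) by (auto simp: count_eq_zero_iff simp del: mset.simps)
  consider "a < b" | "a = b" | "b < a" by linarith
  then show ?case
  proof cases
    case 1
    have "count (mset (b # ys)) a < count (mset (a # xs)) a"
      using absent_y[OF 1] by simp
    moreover have "count (mset (a # xs)) z = count (mset (b # ys)) z" if "z < a" for z
      using absent_x absent_y that 1 by (metis less_trans)
    ultimately show ?thesis using 1 by (auto simp del: mset.simps)
  next
    case 2
    then show ?thesis using Cons.IH Cons.prems by simp
  next
    case 3
    have "\<not> (count (mset (b # ys)) x < count (mset (a # xs)) x
      \<and> (\<forall>y<x. count (mset (a # xs)) y = count (mset (b # ys)) y))" for x
    proof (cases "x \<le> b")
      case True
      then have "count (mset (a # xs)) x = 0" using 3 by (intro absent_x) simp
      then show ?thesis by (metis not_less_zero)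
    next
      case False
      moreover have "count (mset (a # xs)) b \<noteq> count (mset (b # ys)) b"
        using absent_x[OF 3] by simp
      ultimately show ?thesis by (meson not_le)
    qed
    then show ?thesis using 3 by (auto simp del: mset.simps)
  qed
qed

lemma sorted_LO:
  assumes "set_mset S \<subseteq> {..<M}"
  shows "sorted (LO L M S)"
proof -
  have "sorted (sorted_list_of_multiset S)"
    by (metis mset_sorted_list_of_multiset sorted_list_of_multiset_mset sorted_sort)
  then show ?thesis using assms by (auto simp: LO_def sorted_append)
qed

text \<open>
  Padding does not disturb the criterion: with equal multiplicities below \<open>M\<close> the two
  multisets coincide, and then so do their paddings.
\<close>

lemma LO_less_iff_count:
  assumes "size S \<le> L" "size T \<le> L" "set_mset S \<subseteq> {..<M}" "set_mset T \<subseteq> {..<M}"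
  shows "LO L M S < LO L M T \<longleftrightarrow>
    (\<exists>x. count T x < count S x \<and> (\<forall>y<x. count S y = count T y))"
proof -
  have cnt: "count (mset (LO L M U)) x = count U x + (if x = M then L - size U else 0)" for U x
    by (simp add: LO_def)
  have outside: "count S x = 0" "count T x = 0" if "M \<le> x" for x
    using that assms(3,4) by (auto simp: count_eq_zero_iff)
  have "count (mset (LO L M T)) x < count (mset (LO L M S)) x
      \<and> (\<forall>y<x. count (mset (LO L M S)) y = count (mset (LO L M T)) y)
    \<longleftrightarrow> count T x < count S x \<and> (\<forall>y<x. count S y = count T y)" for x
  proof (cases "x < M")
    case True
    then show ?thesis unfolding cnt by auto
  next
    case False
    have "S = T" if "\<forall>y<x. count (mset (LO L M S)) y = count (mset (LO L M T)) y"
    proof (rule multiset_eqI)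
      fix y
      show "count S y = count T y"
        using that[rule_format, of y] outside[of y] False unfolding cnt by (cases "y < M") auto
    qed
    then show ?thesis using False outside[of x] by auto
  qed
  then show ?thesis
    using sorted_less_iff_count[of "LO L M S" "LO L M T"] assms by (simp add: length_LO sorted_LO)
qed

lemma LO_mset_set_less_iff:
  assumes "finite A" "finite B" "card A \<le> L" "card B \<le> L" "A \<subseteq> {..<M}" "B \<subseteq> {..<M}"
  shows "LO L M (mset_set A) < LO L M (mset_set B) \<longleftrightarrow>
    (\<exists>x\<in>A - B. \<forall>y<x. y \<in> A \<longleftrightarrow> y \<in> B)"
proof -
  have "LO L M (mset_set A) < LO L M (mset_set B) \<longleftrightarrow>
    (\<exists>x. count (mset_set B) x < count (mset_set A) x
      \<and> (\<forall>y<x. count (mset_set A) y = count (mset_set B) y))"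
    using assms by (intro LO_less_iff_count) auto
  then show ?thesis using assms(1,2) by (auto simp: count_mset_set' split: if_splits)
qed

text \<open>
  Whether the first difference of two sets lies below \<open>s\<close> can be read off from their parts
  below \<open>s\<close>. This turns statements about the neighbours indexed so far into statements
  about final neighbour sets.
\<close>

lemma first_difference_below:
  fixes A B :: "nat set"
  shows "(\<exists>x\<in>(A \<inter> {..<s}) - (B \<inter> {..<s}). \<forall>y<x. y \<in> A \<inter> {..<s} \<longleftrightarrow> y \<in> B \<inter> {..<s})
    \<longleftrightarrow> (\<exists>x\<in>(A - B) \<inter> {..<s}. \<forall>y<x. y \<in> A \<longleftrightarrow> y \<in> B)"
proof (rule bex_cong)
  fix x assume "x \<in> (A - B) \<inter> {..<s}"
  then have "y < s" if "y < x" for y using that by simp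
  then show "(\<forall>y<x. y \<in> A \<inter> {..<s} \<longleftrightarrow> y \<in> B \<inter> {..<s}) \<longleftrightarrow> (\<forall>y<x. y \<in> A \<longleftrightarrow> y \<in> B)"
    by simp
qed blast

lemma LO_mset_set_inj:
  assumes "finite A" "finite B" "A \<subseteq> {..<M}" "B \<subseteq> {..<M}"
    and "LO L M (mset_set A) = LO L M (mset_set B)"
  shows "A = B"
proof -
  have "x \<in> A \<longleftrightarrow> x \<in> B" for x
  proof (cases "x < M")
    case True
    then have "x \<in> set (LO L M (mset_set C)) \<longleftrightarrow> x \<in> C" if "finite C" for C
      using that by (auto simp: LO_def)
    then show ?thesis using assms(1,2,5) by metis
  next
    case False
    then show ?thesis using assms by auto
  qed
  then show ?thesis by blast
qed

text \<open>
  Ranks count the smaller values, and counting smaller values is a strictly monotone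
  renumbering of a finite set.
\<close>

lemma card_less_filter_iff:
  fixes x y :: "'a :: linorder"
  assumes "finite X" "x \<in> X"
  shows "card {z \<in> X. z < x} < card {z \<in> X. z < y} \<longleftrightarrow> x < y"
proof
  assume "x < y"
  then have "{z \<in> X. z < x} \<subset> {z \<in> X. z < y}" using assms(2) by auto
  then show "card {z \<in> X. z < x} < card {z \<in> X. z < y}" using assms(1) by (intro psubset_card_mono) auto
next
  assume less: "card {z \<in> X. z < x} < card {z \<in> X. z < y}"
  show "x < y"
  proof (rule ccontr)
    assume "\<not> x < y"
    then have "{z \<in> X. z < y} \<subseteq> {z \<in> X. z < x}" by auto
    then have "card {z \<in> X. z < y} \<le> card {z \<in> X. z < x}" using assms(1) by (intro card_mono) auto
    then show False using less by simp
  qed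
qed

section \<open>The greedy choices seen from the final indexing\<close>

text \<open>
  Later rounds only add indexes, so the partial indexing for which \<open>v\<close> was chosen
  is recovered from any later one by forgetting the indexes that are not below that of
  \<open>v\<close>. The whole history of a run can thus be read off from its output.
\<close>

lemma algU_run_choice:
  assumes "algU_run G m J" "v \<in> dom J"
  shows "is_arg_min
    (\<lambda>u. graph_LO G (temp_nbrs G (the (J v)) (J |` {w. the (J w) < the (J v)}) u))
    (\<lambda>u. u \<in> unindexed G (J |` {w. the (J w) < the (J v)})) v"
  using assms
proof induction
  case init
  then show ?case by simp
next
  case (step s J x)
  have x: "x \<notin> dom J"
    using step.hyps(2) by (auto simp: is_arg_min_def unindexed_def)
  have below: "the (J w) < s" if "w \<in> dom J" for w
    using algU_run_dom[OF step.hyps(1)] that by (auto simp: bij_betw_def)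
  show ?case
  proof (cases "v = x")
    case True
    have eq: "J(x \<mapsto> s) |` {w. the ((J(x \<mapsto> s)) w) < s} = J"
    proof
      fix w
      show "(J(x \<mapsto> s) |` {w. the ((J(x \<mapsto> s)) w) < s}) w = J w"
        using x below[of w] by (cases "J w") (auto simp: restrict_map_def)
    qed
    show ?thesis using step.hyps(2) by (simp only: True fun_upd_same option.sel eq)
  next
    case False
    then have v: "v \<in> dom J" using step.prems by (simp add: domIff)
    have eq: "J(x \<mapsto> s) |` {w. the ((J(x \<mapsto> s)) w) < the (J v)} = J |` {w. the (J w) < the (J v)}"
    proof
      fix w
      show "(J(x \<mapsto> s) |` {w. the ((J(x \<mapsto> s)) w) < the (J v)}) w
          = (J |` {w. the (J w) < the (J v)}) w"
        using x below[OF v] by (cases "J w") (auto simp: restrict_map_def)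
    qed
    have "(J(x \<mapsto> s)) v = J v" using False by simp
    then show ?thesis using step.IH[OF v] by (simp only: eq)
  qed
qed

definition indexing_before :: "('a, 'b) pre_digraph \<Rightarrow> ('a \<Rightarrow> nat) \<Rightarrow> nat \<Rightarrow> ('a \<rightharpoonup> nat)" where
  "indexing_before G I s = (\<lambda>u. if u \<in> verts G \<and> I u < s then Some (I u) else None)"

text \<open>
  The outputs of the algorithm, described without reference to its run: a bijective indexing in
  which every node is a legitimate choice once its predecessors are indexed.
\<close>

locale algU_indexing = graph G for G :: "('a, 'b) pre_digraph" +
  fixes I :: "'a \<Rightarrow> nat"
  assumes bij: "bij_betw I (verts G) {..<card (verts G)}"
    and choice: "v \<in> verts G \<Longrightarrow> is_arg_min
      (\<lambda>u. graph_LO G (temp_nbrs G (I v) (indexing_before G I (I v)) u))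
      (\<lambda>u. u \<in> unindexed G (indexing_before G I (I v))) v"

lemma algU_output_indexing:
  assumes "graph G" "algU_output G I"
  shows "algU_indexing G I"
proof -
  interpret graph G by fact
  obtain J where J: "algU_run G (card (verts G)) J" "\<And>v. v \<in> verts G \<Longrightarrow> J v = Some (I v)"
    using assms(2) by (auto simp: algU_output_def)
  have dom: "dom J = verts G"
    using algU_run_dom[OF J(1)] J(2) by auto
  have before: "J |` {w. the (J w) < s} = indexing_before G I s" for s
  proof
    fix w
    show "(J |` {w. the (J w) < s}) w = indexing_before G I s w"
    proof (cases "w \<in> verts G")
      case False
      then have "J w = None" using dom by (metis domIff)
      then show ?thesis using False by (simp add: restrict_map_def indexing_before_def)
    qed (simp add: J(2) restrict_map_def indexing_before_def)
  qed
  show ?thesis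
  proof
    show "bij_betw I (verts G) {..<card (verts G)}"
      by (rule algU_output_bij_betw[OF assms])
    fix v assume v: "v \<in> verts G"
    show "is_arg_min
      (\<lambda>u. graph_LO G (temp_nbrs G (I v) (indexing_before G I (I v)) u))
      (\<lambda>u. u \<in> unindexed G (indexing_before G I (I v))) v"
      using algU_run_choice[OF J(1), of v] v dom J(2)[OF v] by (simp add: before)
  qed
qed

context algU_indexing
begin

section \<open>Neighbour sets and temporary indexes\<close>

abbreviation n :: nat where
  "n \<equiv> card (verts G)"

abbreviation N :: "'a \<Rightarrow> nat set" where
  "N v \<equiv> I ` neighbors G v"

abbreviation tmp :: "nat \<Rightarrow> 'a \<Rightarrow> nat" where
  "tmp s \<equiv> temp_index G s (indexing_before G I s)"

lemma inj: "inj_on I (verts G)"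
  using bij by (rule bij_betw_imp_inj_on)

lemma index_less: "v \<in> verts G \<Longrightarrow> I v < n"
  using bij by (auto simp: bij_betw_def)

lemma neighbors_verts: "neighbors G v \<subseteq> verts G"
  by (auto simp: neighbors_def dest: adj_in_verts)

lemma finite_neighbors [simp]: "finite (neighbors G v)"
  using neighbors_verts finite_verts by (rule finite_subset)

lemma neighbors_sym: "u \<in> neighbors G v \<longleftrightarrow> v \<in> neighbors G u"
  using sym_arcs by (auto simp: neighbors_def symmetric_def dest: symD)

lemma neighbors_irrefl: "v \<notin> neighbors G v"
  by (auto simp: neighbors_def dest: adj_not_same)

lemma card_neighbors: "v \<in> verts G \<Longrightarrow> card (neighbors G v) \<le> n - 1"
proof -
  assume v: "v \<in> verts G"
  have "card (neighbors G v) \<le> card (verts G - {v})"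
    using neighbors_verts neighbors_irrefl by (intro card_mono) auto
  then show ?thesis using v by simp
qed

lemma N_bound: "N v \<subseteq> {..<n}"
  using neighbors_verts index_less by blast

lemma card_N: "v \<in> verts G \<Longrightarrow> card (N v) \<le> n - 1"
  using card_neighbors card_image_le[OF finite_neighbors] le_trans by blast

lemma index_in_N_iff: "u \<in> verts G \<Longrightarrow> I u \<in> N v \<longleftrightarrow> u \<in> neighbors G v"
  using inj neighbors_verts[of v] by (auto simp: inj_on_image_mem_iff)

lemma dom_before: "dom (indexing_before G I s) = {u \<in> verts G. I u < s}"
  by (auto simp: indexing_before_def split: if_splits)

lemma unindexed_before: "unindexed G (indexing_before G I s) = {u \<in> verts G. s \<le> I u}"
  by (auto simp: unindexed_def dom_before)

lemma indexed_nbrs_before: "indexed_nbrs G (indexing_before G I s) v = N v \<inter> {..<s}"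
proof -
  have "neighbors G v \<inter> {u \<in> verts G. I u < s} = {u \<in> neighbors G v. I u < s}"
    using neighbors_verts by auto
  then have "indexed_nbrs G (indexing_before G I s) v
      = (\<lambda>u. the (indexing_before G I s u)) ` {u \<in> neighbors G v. I u < s}"
    by (simp only: indexed_nbrs_def dom_before)
  also have "\<dots> = I ` {u \<in> neighbors G v. I u < s}"
    using neighbors_verts by (intro image_cong) (auto simp: indexing_before_def)
  also have "\<dots> = N v \<inter> {..<s}" by auto
  finally show ?thesis .
qed

lemma tmp_indexed: "u \<in> verts G \<Longrightarrow> I u < s \<Longrightarrow> tmp s u = I u"
  by (simp add: temp_index_def indexing_before_def)

lemma tmp_unindexed: "s \<le> I u \<Longrightarrow> tmp s u = rank G (indexing_before G I s) u + s"
  by (simp add: temp_index_def indexing_before_def)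

text \<open>
  Unindexed nodes have temporary indexes at least \<open>s\<close>, so the values below \<open>s\<close>
  are final.
\<close>

lemma tmp_eq_small_iff: "u \<in> verts G \<Longrightarrow> i < s \<Longrightarrow> tmp s u = i \<longleftrightarrow> I u = i"
  by (cases "I u < s") (auto simp: tmp_indexed tmp_unindexed)

lemma finite_part: "finite (N v \<inter> {..<s})" by simp

lemma card_part: "v \<in> verts G \<Longrightarrow> card (N v \<inter> {..<s}) \<le> n - 1"
  by (rule le_trans[OF card_mono card_N]) auto

lemma part_bound: "N v \<inter> {..<s} \<subseteq> {..<n}"
  using N_bound by blast

lemma rank_less_iff:
  assumes "u \<in> verts G" "s \<le> I u" "w \<in> verts G"
  shows "rank G (indexing_before G I s) u < rank G (indexing_before G I s) w \<longleftrightarrow>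
    (\<exists>x\<in>(N u - N w) \<inter> {..<s}. \<forall>y<x. y \<in> N u \<longleftrightarrow> y \<in> N w)"
proof -
  have "rank G (indexing_before G I s) u < rank G (indexing_before G I s) w \<longleftrightarrow>
    graph_LO G (mset_set (N u \<inter> {..<s})) < graph_LO G (mset_set (N w \<inter> {..<s}))"
    unfolding rank_def indexed_nbrs_before unindexed_before
    using assms by (subst card_less_filter_iff) auto
  also have "\<dots> \<longleftrightarrow> (\<exists>x\<in>(N u \<inter> {..<s}) - (N w \<inter> {..<s}).
      \<forall>y<x. y \<in> N u \<inter> {..<s} \<longleftrightarrow> y \<in> N w \<inter> {..<s})"
    using assms by (intro LO_mset_set_less_iff finite_part card_part part_bound)
  also have "\<dots> \<longleftrightarrow> (\<exists>x\<in>(N u - N w) \<inter> {..<s}. \<forall>y<x. y \<in> N u \<longleftrightarrow> y \<in> N w)"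
    by (rule first_difference_below)
  finally show ?thesis .
qed

lemma rank_eqD:
  assumes "u \<in> verts G" "s \<le> I u" "w \<in> verts G" "s \<le> I w"
    and "rank G (indexing_before G I s) u = rank G (indexing_before G I s) w"
  shows "N u \<inter> {..<s} = N w \<inter> {..<s}"
proof -
  let ?lo = "\<lambda>u. graph_LO G (mset_set (N u \<inter> {..<s}))"
  have "\<not> ?lo u < ?lo w" "\<not> ?lo w < ?lo u"
    using assms(5) card_less_filter_iff[of "?lo ` {u \<in> verts G. s \<le> I u}" "?lo u" "?lo w"]
      card_less_filter_iff[of "?lo ` {u \<in> verts G. s \<le> I u}" "?lo w" "?lo u"] assms(1-4)
    by (auto simp: rank_def indexed_nbrs_before unindexed_before)
  then have "?lo u = ?lo w" by simp
  then show ?thesis by (intro LO_mset_set_inj[OF finite_part finite_part part_bound part_bound])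
qed

text \<open>
  At most as many values occur as there are unindexed nodes, and \<open>n - s\<close> nodes are
  unindexed at round \<open>s\<close>. Temporary indexes are therefore smaller than the padding value
  \<open>n\<close>, as the multiplicity criterion requires.
\<close>

lemma rank_bound:
  assumes "u \<in> verts G" "s \<le> I u"
  shows "rank G (indexing_before G I s) u + s < n"
proof -
  let ?U = "{u \<in> verts G. s \<le> I u}"
  let ?lo = "\<lambda>u. graph_LO G (mset_set (N u \<inter> {..<s}))"
  have "rank G (indexing_before G I s) u = card {x \<in> ?lo ` ?U. x < ?lo u}"
    by (simp add: rank_def indexed_nbrs_before unindexed_before)
  also have "\<dots> < card (?lo ` ?U)"
    using assms by (intro psubset_card_mono) auto
  also have "\<dots> \<le> card ?U" by (rule card_image_le) simp
  also have "card ?U = card (I ` ?U)"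
    using inj by (intro card_image[symmetric]) (auto simp: inj_on_def)
  also have "\<dots> \<le> card {s..<n}"
    using index_less by (intro card_mono) auto
  finally show ?thesis by simp
qed

lemma tmp_bound: "u \<in> verts G \<Longrightarrow> tmp s u < n"
  by (cases "I u < s") (auto simp: tmp_indexed tmp_unindexed index_less rank_bound)

lemma count_temp_nbrs:
  "count (temp_nbrs G s (indexing_before G I s) v) i = card {u \<in> neighbors G v. tmp s u = i}"
proof -
  have "{x \<in> neighbors G v. i = tmp s x} = {u \<in> neighbors G v. tmp s u = i}" by auto
  then show ?thesis
    by (simp add: temp_nbrs_def count_image_mset' filter_mset_mset_set flip: size_eq_sum_mset)
qed

lemma count_temp_nbrs_small:
  assumes "i < s"
  shows "count (temp_nbrs G s (indexing_before G I s) v) i = (if i \<in> N v then 1 else 0)"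
proof -
  have eq: "{u \<in> neighbors G v. tmp s u = i} = {u \<in> neighbors G v. I u = i}"
    using tmp_eq_small_iff[OF _ assms] neighbors_verts by auto
  show ?thesis
  proof (cases "i \<in> N v")
    case True
    then obtain u where u: "u \<in> neighbors G v" "I u = i" by auto
    then have "{u \<in> neighbors G v. I u = i} = {u}"
      using inj neighbors_verts by (auto simp: inj_on_def subset_iff)
    then show ?thesis using True by (simp add: count_temp_nbrs eq)
  next
    case False
    then have "{u \<in> neighbors G v. I u = i} = {}" by auto
    then show ?thesis using False by (simp add: count_temp_nbrs eq)
  qed
qed

text \<open>The minimality of the chosen node in terms of multiplicities.\<close>

lemma choice_count:
  assumes "v \<in> verts G" "u \<in> verts G" "I v < I u"
  shows "\<not> (\<exists>x. count (temp_nbrs G (I v) (indexing_before G I (I v)) v) x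
          < count (temp_nbrs G (I v) (indexing_before G I (I v)) u) x
    \<and> (\<forall>y<x. count (temp_nbrs G (I v) (indexing_before G I (I v)) u) y
          = count (temp_nbrs G (I v) (indexing_before G I (I v)) v) y))"
proof -
  let ?T = "temp_nbrs G (I v) (indexing_before G I (I v))"
  have "\<not> graph_LO G (?T u) < graph_LO G (?T v)"
    using choice[OF assms(1)] assms by (auto simp: is_arg_min_def unindexed_before)
  moreover have "size (?T w) \<le> n - 1" if "w \<in> verts G" for w
    using card_neighbors[OF that] by (simp add: temp_nbrs_def)
  moreover have "set_mset (?T w) \<subseteq> {..<n}" for w
    using tmp_bound neighbors_verts by (auto simp: temp_nbrs_def)
  ultimately show ?thesis
    using assms(1,2) by (subst (asm) LO_less_iff_count) auto
qed

section \<open>How early neighbours determine the final order\<close>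

text \<open>
  If \<open>w\<close> were indexed first, then in its round \<open>u\<close> would be available, and the
  temporary multisets of \<open>u\<close> and \<open>w\<close> would have the same first difference
  \<open>x\<close> as the final sets, in favour of \<open>u\<close>.
\<close>

lemma index_less_of_first_difference:
  assumes "u \<in> verts G" "w \<in> verts G" "x \<in> N u - N w" "\<forall>y<x. y \<in> N u \<longleftrightarrow> y \<in> N w" "x < I w"
  shows "I u < I w"
proof (rule ccontr)
  assume "\<not> I u < I w"
  moreover have "u \<noteq> w" using assms(3) by auto
  ultimately have "I w < I u"
    using inj assms(1,2) by (metis inj_onD linorder_neqE_nat)
  have small: "count (temp_nbrs G (I w) (indexing_before G I (I w)) v) y = (if y \<in> N v then 1 else 0)"
    if "y \<le> x" for y v
    using that assms(5) by (intro count_temp_nbrs_small) simp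
  have "x \<in> N u" "x \<notin> N w" using assms(3) by blast+
  then have "count (temp_nbrs G (I w) (indexing_before G I (I w)) w) x
      < count (temp_nbrs G (I w) (indexing_before G I (I w)) u) x"
    by (simp only: small order_refl if_True if_False zero_less_one)
  moreover have "count (temp_nbrs G (I w) (indexing_before G I (I w)) u) y
      = count (temp_nbrs G (I w) (indexing_before G I (I w)) w) y" if "y < x" for y
    using assms(4) that by (simp only: small less_imp_le)
  ultimately show False
    using choice_count[OF assms(2,1) \<open>I w < I u\<close>] by blast
qed

text \<open>
  A smaller rank at round \<open>s\<close> means a favourable first difference below \<open>s\<close>, and
  this difference persists: the final order refines the order of temporary indexes.
\<close>

lemma index_less_of_tmp_less:
  assumes "u \<in> verts G" "w \<in> verts G" "s \<le> I w" "tmp s u < tmp s w"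
  shows "I u < I w"
proof (cases "I u < s")
  case True
  then show ?thesis using assms(3) by simp
next
  case False
  then have "rank G (indexing_before G I s) u < rank G (indexing_before G I s) w"
    using assms by (simp add: tmp_unindexed)
  then obtain x where "x \<in> N u - N w" "x < s" "\<forall>y<x. y \<in> N u \<longleftrightarrow> y \<in> N w"
    using rank_less_iff[of u s w] assms False by auto
  then show ?thesis
    using index_less_of_first_difference assms(1-3) by auto
qed

text \<open>
  Nodes of equal rank at round \<open>I a\<close> have the same neighbours below \<open>I a\<close>, so being
  adjacent to \<open>a\<close> makes \<open>I a\<close> the first difference.
\<close>

lemma index_less_of_tmp_eq:
  assumes "a \<in> verts G" "u \<in> neighbors G a" "w \<in> verts G - neighbors G a" "I a < I w"
    and "I a \<le> I u" "tmp (I a) u = tmp (I a) w"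
  shows "I u < I w"
proof -
  have u: "u \<in> verts G" using assms(2) neighbors_verts by blast
  have "N u \<inter> {..<I a} = N w \<inter> {..<I a}"
    using assms u by (intro rank_eqD) (auto simp: tmp_unindexed)
  moreover have "I a \<in> N u - N w"
    using assms(1-3) by (simp add: index_in_N_iff neighbors_sym)
  ultimately show ?thesis
    using index_less_of_first_difference[of u w "I a"] u assms(3,4) by blast
qed

section \<open>Monotonicity of the neighbour sequences\<close>

text \<open>
  From a first difference that favours \<open>b\<close>, the proof shows that \<open>b\<close> has a smaller
  temporary sequence than \<open>a\<close> in the round that chose \<open>a\<close>. The neighbours of
  \<open>a\<close> and \<open>b\<close> of a given temporary index are matched by the transposition of
  \<open>a\<close> and \<open>b\<close>. It fixes common neighbours, and if \<open>a\<close> and \<open>b\<close>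
  are adjacent it matches the neighbour \<open>b\<close> of \<open>a\<close> with the neighbour
  \<open>a\<close> of \<open>b\<close>, which has the same temporary index.
\<close>

theorem LO_nbrs_mono:
  assumes a: "a \<in> verts G" and b: "b \<in> verts G" and ab: "I a < I b"
  shows "graph_LO G (mset_set (N a - {I b})) \<le> graph_LO G (mset_set (N b - {I a}))"
proof (rule ccontr)
  assume "\<not> ?thesis"
  then have "graph_LO G (mset_set (N b - {I a})) < graph_LO G (mset_set (N a - {I b}))" by simp
  moreover have "card (N v - {i}) \<le> n - 1" if "v \<in> verts G" for v i
    by (rule le_trans[OF card_mono card_N[OF that]]) auto
  moreover have "N v - {i} \<subseteq> {..<n}" for v i using N_bound by blast
  ultimately have "\<exists>x\<in>(N b - {I a}) - (N a - {I b}). \<forall>y<x. y \<in> N b - {I a} \<longleftrightarrow> y \<in> N a - {I b}"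
    using a b by (subst (asm) LO_mset_set_less_iff) auto
  then obtain x where x: "x \<in> N b - {I a}" "x \<notin> N a - {I b}"
    and below: "\<And>y. y < x \<Longrightarrow> y \<in> N b - {I a} \<longleftrightarrow> y \<in> N a - {I b}" by blast
  have "I b \<notin> N b" using b by (simp add: index_in_N_iff neighbors_irrefl)
  then have "x \<noteq> I b" using x(1) by blast
  then have xa: "x \<notin> N a" using x(2) by simp
  obtain c where c: "c \<in> neighbors G b" "I c = x" "c \<in> verts G"
    using x(1) neighbors_verts by blast
  have ca: "c \<notin> neighbors G a" using xa c by auto
  have "\<not> x < I a"
  proof
    assume less: "x < I a"
    have "I b < I a"
    proof (rule index_less_of_first_difference[OF b a])
      show "x \<in> N b - N a" using x xa by blast
      have "y \<in> N b \<longleftrightarrow> y \<in> N a" if "y < x" for y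
        using below[OF that] that less ab by simp
      then show "\<forall>y<x. y \<in> N b \<longleftrightarrow> y \<in> N a" by blast
    qed (fact less)
    then show False using ab by simp
  qed
  then have ax: "I a < x" using x(1) by auto
  define s where "s = I a"
  have "y \<in> N a \<longleftrightarrow> y \<in> N b" if "y < s" for y
    using below[of y] that ax ab unfolding s_def by simp
  then have "N a \<inter> {..<s} = N b \<inter> {..<s}" by blast
  then have tmp_ab: "tmp s a = tmp s b"
    using ab by (simp add: tmp_unindexed s_def rank_def indexed_nbrs_before)
  define peers where "peers v r = {u \<in> neighbors G v. tmp s u = r}" for v r
  define f where "f = transpose a b"
  have peers_a: "f ` peers a r \<subseteq> peers b r" if "r \<le> tmp s c" for r
  proof -
    have "f u \<in> peers b r" if u: "u \<in> peers a r" for u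
    proof (cases "u = b")
      case True
      then show ?thesis using u tmp_ab by (auto simp: f_def peers_def neighbors_sym)
    next
      case False
      have u': "u \<in> neighbors G a" "u \<in> verts G" "u \<noteq> a"
        using u neighbors_verts neighbors_irrefl by (auto simp: peers_def)
      have "I u < x"
      proof (cases "I u < s \<or> r < tmp s c")
        \<comment> \<open>Earlier rounds and smaller ranks precede the node \<open>c\<close> of index \<open>x\<close>; in the rank of
          \<open>c\<close> it matters that \<open>u\<close> is adjacent to \<open>a\<close> and \<open>c\<close> is not.\<close>
        case True
        then show ?thesis
          using index_less_of_tmp_less[of u c s] u u' c ax by (auto simp: peers_def s_def)
      next
        case False
        then show ?thesis
          using index_less_of_tmp_eq[OF a u'(1), of c] u c ca ax \<open>r \<le> tmp s c\<close>
          by (auto simp: peers_def s_def)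
      qed
      moreover have "I u \<noteq> I b" using False inj u' b by (auto dest: inj_onD)
      ultimately have "I u \<in> N b" using below[of "I u"] u'(1) by auto
      then show ?thesis
        using u u' False by (auto simp: index_in_N_iff f_def peers_def)
    qed
    then show ?thesis by blast
  qed
  have peers_b: "f ` peers b r \<subseteq> peers a r" if "r < tmp s c" for r
  proof -
    have "f u \<in> peers a r" if u: "u \<in> peers b r" for u
    proof (cases "u = a")
      case True
      then show ?thesis using u tmp_ab by (auto simp: f_def peers_def neighbors_sym)
    next
      case False
      have u': "u \<in> neighbors G b" "u \<in> verts G" "u \<noteq> b"
        using u neighbors_verts neighbors_irrefl by (auto simp: peers_def)
      have "I u < x"
        using index_less_of_tmp_less[of u c s] u u' c ax \<open>r < tmp s c\<close> by (auto simp: peers_def s_def)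
      moreover have "I u \<noteq> I a" using False inj u' a by (auto dest: inj_onD)
      ultimately have "I u \<in> N a" using below[of "I u"] u'(1) by auto
      then show ?thesis
        using u u' False by (auto simp: index_in_N_iff f_def peers_def)
    qed
    then show ?thesis by blast
  qed
  have card_f: "card (f ` X) = card X" for X :: "'a set"
    by (rule card_image) (simp add: f_def)
  have fin: "finite (peers v r)" for v r by (simp add: peers_def)
  have cnt: "count (temp_nbrs G (I a) (indexing_before G I (I a)) v) r = card (peers v r)" for v r
    by (simp add: count_temp_nbrs peers_def s_def)
  have "card (peers a r) = card (peers b r)" if "r < tmp s c" for r
    using card_mono[OF fin peers_a[of r]] card_mono[OF fin peers_b[of r]] that
    by (simp add: card_f)
  moreover have "card (peers a (tmp s c)) < card (peers b (tmp s c))"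
  proof -
    have "f c = c" using c ca ax ab neighbors_irrefl by (auto simp: f_def transpose_def)
    then have "c \<notin> f ` peers a (tmp s c)"
      using ca by (auto simp: f_def peers_def transpose_eq_iff)
    moreover have "c \<in> peers b (tmp s c)" using c by (simp add: peers_def)
    ultimately have "f ` peers a (tmp s c) \<subset> peers b (tmp s c)"
      using peers_a[of "tmp s c"] by blast
    then show ?thesis using psubset_card_mono[OF fin] card_f by metis
  qed
  ultimately show False
    using choice_count[OF a b ab] unfolding cnt by auto
qed

end

theorem theorem3:
  fixes G :: "('a, 'b) pre_digraph" and I :: "'a \<Rightarrow> nat" and n :: nat
  assumes "graph G"
    and "n = card (verts G)"
    and "n \<ge> 1"
    and "algU_output G I"
  shows "\<forall>v\<in>{..<n - 1}. LO (n - 1) n (mset_set (nbr_indexes G I v - {v + 1}))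
           \<le> LO (n - 1) n (mset_set (nbr_indexes G I (v + 1) - {v}))"
proof
  interpret algU_indexing G I by (rule algU_output_indexing[OF assms(1,4)])
  fix v assume "v \<in> {..<n - 1}"
  then have v: "v < card (verts G)" "v + 1 < card (verts G)" using assms(2) by auto
  define node where "node = inv_into (verts G) I"
  have node: "node i \<in> verts G" "I (node i) = i" if "i < card (verts G)" for i
    using that bij by (auto simp: node_def bij_betw_def intro!: inv_into_into f_inv_into_f)
  show "LO (n - 1) n (mset_set (nbr_indexes G I v - {v + 1}))
           \<le> LO (n - 1) n (mset_set (nbr_indexes G I (v + 1) - {v}))"
    using LO_nbrs_mono[of "node v" "node (v + 1)"] node[OF v(1)] node[OF v(2)]
    by (simp add: nbr_indexes_def node_def[symmetric] assms(2))
qed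

end
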